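(* Let $A$, $f_A$, $f$, $h$, $F$, $H$ be as in the context. Suppose that $h(\mathcal{F}^u_f(p))=\mathcal{F}^u_{f_A}(h(p))$ for every $p\in\mathbb{T}^3$. Then $f$ is not accessible.
   Context: $A\in SL(3,\mathbb{Z})$ has eigenvalues $0<\lambda_1<1<\lambda_2<\lambda_3$; $f_A$ is the induced automorphism of $\mathbb{T}^3=\mathbb{R}^3/\mathbb{Z}^3$. $f$ is a diffeomorphism of $\mathbb{T}^3$ sufficiently $C^1$-close to $f_A$ so that it is Anosov, partially hyperbolic with one-dimensional strong stable, center and strong unstable bundles, and $h$ is the homeomorphism close to the identity with $h\circ f=f_A\circ h$. $\mathcal{F}^s_f,\mathcal{F}^u_f$ denote the strong stable and strong unstable foliations of $f$ and $\mathcal{F}^s_{f_A},\mathcal{F}^u_{f_A}$ those of $f_A$ (projections of the lines parallel to the $\lambda_1$- and $\lambda_3$-eigenlines). $f$ is accessible if any two points of $\mathbb{T}^3$ can be joined by a piecewise smooth path each of whose pieces lies in a single strong stable or strong unstable leaf of $f$. *)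

theory Defs
  imports "HOL-Analysis.Analysis"
begin

text \<open>We work on the universal cover R^3 of T^3 = R^3/Z^3, with Z^3-equivariant lifts.\<close>

definition int_vec :: "real^3 \<Rightarrow> bool" where
  "int_vec k \<longleftrightarrow> (\<forall>i. k $ i \<in> \<int>)"

text \<open>Z^3-saturation: preimage in R^3 of the projection of S to the torus.\<close>
definition zsat :: "(real^3) set \<Rightarrow> (real^3) set" where
  "zsat S = {z. \<exists>y\<in>S. int_vec (z - y)}"

definition realA :: "int^3^3 \<Rightarrow> real^3^3" where
  "realA A = (\<chi> i j. real_of_int (A $ i $ j))"

text \<open>F is a lift of a C^1 diffeomorphism f of T^3 in the homotopy class of f_A,
  with derivative matrix field F'.\<close>
definition torus_lift_diffeo :: "int^3^3 \<Rightarrow> (real^3 \<Rightarrow> real^3) \<Rightarrow> (real^3 \<Rightarrow> real^3^3) \<Rightarrow> bool" where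
  "torus_lift_diffeo A F F' \<longleftrightarrow>
     (\<forall>x. (F has_derivative (\<lambda>v. F' x *v v)) (at x)) \<and> continuous_on UNIV F' \<and>
     (\<forall>x. det (F' x) \<noteq> 0) \<and> bij F \<and>
     (\<forall>x k. int_vec k \<longrightarrow> F (x + k) = F x + realA A *v k)"

text \<open>H is a lift of a homeomorphism h of T^3 homotopic to the identity with h o f = f_A o h.\<close>
definition torus_conj :: "int^3^3 \<Rightarrow> (real^3 \<Rightarrow> real^3) \<Rightarrow> (real^3 \<Rightarrow> real^3) \<Rightarrow> bool" where
  "torus_conj A F H \<longleftrightarrow> (\<exists>G. homeomorphism UNIV UNIV H G) \<and>
     (\<forall>x k. int_vec k \<longrightarrow> H (x + k) = H x + k) \<and>
     (\<forall>x. H (F x) = realA A *v H x)"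

text \<open>Partially hyperbolic (and Anosov) splitting E^s + E^c + E^u into lines for the lift F,
  each line field given by a continuous nowhere-vanishing vector field, Z^3-periodic
  (so it descends to T^3), DF-invariant, with rates
  a1 <= b1 < a2 <= b2 < a3 <= b3, b1 < 1 < a2 (center expanding: f Anosov).\<close>
definition ph_splitting :: "(real^3 \<Rightarrow> real^3) \<Rightarrow> (real^3 \<Rightarrow> real^3) \<Rightarrow> (real^3 \<Rightarrow> real^3) \<Rightarrow> (real^3 \<Rightarrow> real^3) \<Rightarrow> bool" where
  "ph_splitting F es ec eu \<longleftrightarrow>
     (\<forall>e\<in>{es, ec, eu}.
        continuous_on UNIV e \<and> (\<forall>x. e x \<noteq> 0) \<and>
        (\<forall>x k. int_vec k \<longrightarrow> span {e (x + k)} = span {e x}) \<and>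
        (\<forall>x. frechet_derivative F (at x) (e x) \<in> span {e (F x)})) \<and>
     (\<forall>x. span {es x, ec x, eu x} = UNIV) \<and>
     (\<exists>C a1 b1 a2 b2 a3 b3. C > 0 \<and> 0 < a1 \<and> a1 \<le> b1 \<and> b1 < a2 \<and> a2 \<le> b2 \<and> b2 < a3 \<and> a3 \<le> b3 \<and>
        b1 < 1 \<and> 1 < a2 \<and>
        (\<forall>x n. a1 ^ n / C * norm (es x) \<le> norm (frechet_derivative (F ^^ n) (at x) (es x)) \<and>
               norm (frechet_derivative (F ^^ n) (at x) (es x)) \<le> C * b1 ^ n * norm (es x) \<and>
               a2 ^ n / C * norm (ec x) \<le> norm (frechet_derivative (F ^^ n) (at x) (ec x)) \<and>
               norm (frechet_derivative (F ^^ n) (at x) (ec x)) \<le> C * b2 ^ n * norm (ec x) \<and>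
               a3 ^ n / C * norm (eu x) \<le> norm (frechet_derivative (F ^^ n) (at x) (eu x)) \<and>
               norm (frechet_derivative (F ^^ n) (at x) (eu x)) \<le> C * b3 ^ n * norm (eu x)))"

text \<open>C^1 path on [0,1] everywhere tangent to the line field spanned by e.\<close>
definition tangent_path :: "(real^3 \<Rightarrow> real^3) \<Rightarrow> (real \<Rightarrow> real^3) \<Rightarrow> bool" where
  "tangent_path e \<gamma> \<longleftrightarrow> (\<exists>\<gamma>'. continuous_on {0..1} \<gamma>' \<and>
     (\<forall>t\<in>{0..1}. (\<gamma> has_vector_derivative \<gamma>' t) (at t within {0..1}) \<and> \<gamma>' t \<in> span {e (\<gamma> t)}))"

text \<open>Lifted leaf through x of the one-dimensional foliation tangent to the line field e.\<close>
definition leaf :: "(real^3 \<Rightarrow> real^3) \<Rightarrow> real^3 \<Rightarrow> (real^3) set" where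
  "leaf e x = {\<gamma> 1 | \<gamma>. tangent_path e \<gamma> \<and> \<gamma> 0 = x}"

text \<open>Lifted strong unstable leaf of f_A through x: line through x parallel to the
  eigenline of the eigenvalue l3.\<close>
definition lin_leaf :: "int^3^3 \<Rightarrow> real \<Rightarrow> real^3 \<Rightarrow> (real^3) set" where
  "lin_leaf A l x = {x + v | v. realA A *v v = l *\<^sub>R v}"

text \<open>Accessibility on T^3, read on the cover: any x can be joined by an su-path to
  some lift y + k of any other point y.\<close>
definition su_step :: "(real^3 \<Rightarrow> real^3) \<Rightarrow> (real^3 \<Rightarrow> real^3) \<Rightarrow> ((real^3) \<times> (real^3)) set" where
  "su_step es eu = {(x, y). y \<in> leaf es x \<or> y \<in> leaf eu x}"

definition accessible :: "(real^3 \<Rightarrow> real^3) \<Rightarrow> (real^3 \<Rightarrow> real^3) \<Rightarrow> bool" where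
  "accessible es eu \<longleftrightarrow> (\<forall>x y. \<exists>z. (x, z) \<in> (su_step es eu)\<^sup>* \<and> int_vec (z - y))"

end

theory Submission
  imports Defs
begin

(* Idea of the proof (all on the universal cover R^3).  Let B be the integer
   matrix of A and L the linear map x |-> B x.  The conjugacy H commutes
   with integer translations, hence is at bounded distance from the identity.  Two points on a
   strong stable leaf of F keep bounded distance under iteration, so the
   difference of their H-images has a bounded forward L-orbit: it lies in
   the L-invariant subspace bounded_orbit L.  By hypothesis H maps strong
   unstable leaves into l3-eigenlines modulo Z^3.  Hence along every su-path
   H moves points only by vectors of the additive set
       displacements L l3 = bounded_orbit L + E(l3) + Z^3.
   The center eigenvector v of eigenvalue l2 > 1, l2 <> l3, meets
   bounded_orbit L + E(l3) only in 0, so the line R v meets the displacement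
   set in countably many points.  A point of H^{-1}(H 0 + R v) outside this
   set cannot be reached from 0 modulo Z^3, so f is not accessible. *)

subsection \<open>Integer vectors\<close>

lemma int_vec_0: "int_vec 0"
  unfolding int_vec_def by simp

lemma int_vec_add: "int_vec a \<Longrightarrow> int_vec b \<Longrightarrow> int_vec (a + b)"
  unfolding int_vec_def by auto

lemma int_vec_diff: "int_vec a \<Longrightarrow> int_vec b \<Longrightarrow> int_vec (a - b)"
  unfolding int_vec_def by auto

text \<open>Z^3 is countable; hence a line meets the displacement set defined below
  in only countably many points.\<close>
lemma countable_int_vecs: "countable {k::real^3. int_vec k}"
proof -
  have "{k::real^3. int_vec k} \<subseteq> range (\<lambda>z::int^3. \<chi> i. of_int (z $ i))"
  proof
    fix k :: "real^3" assume "k \<in> {k. int_vec k}"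
    then have "\<forall>i. \<exists>m::int. k $ i = of_int m" unfolding int_vec_def by (auto elim!: Ints_cases)
    then obtain m where "\<forall>i. k $ i = of_int (m i)" by metis
    then have "k = (\<chi> i. of_int ((\<chi> i. m i) $ i))" by (simp add: vec_eq_iff)
    then show "k \<in> range (\<lambda>z::int^3. \<chi> i. of_int (z $ i))" by blast
  qed
  then show ?thesis by (rule countable_subset) simp
qed

subsection \<open>Vectors with bounded forward orbit under a linear map\<close>

definition bounded_orbit :: "('a::real_normed_vector \<Rightarrow> 'a) \<Rightarrow> 'a set" where
  "bounded_orbit L = {w. \<exists>K. \<forall>n. norm ((L ^^ n) w) \<le> K}"

text \<open>Iterates of a linear map are linear.\<close>
lemma linear_iterate:
  fixes L :: "'a::real_vector \<Rightarrow> 'a"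
  assumes "linear L"
  shows "linear (L ^^ n)"
proof (induction n)
  case 0
  show ?case using linear_id by (simp add: id_def)
next
  case (Suc n)
  show ?case using linear_compose[OF Suc.IH assms] by (simp add: o_def)
qed

text \<open>The vectors with bounded orbit form a linear subspace \<dots>\<close>
lemma subspace_bounded_orbit:
  assumes "linear L"
  shows "subspace (bounded_orbit L)"
proof (rule subspaceI)
  note lin = linear_iterate[OF assms]
  show "0 \<in> bounded_orbit L"
    unfolding bounded_orbit_def using linear_0[OF lin] by auto
  fix x y assume "x \<in> bounded_orbit L" "y \<in> bounded_orbit L"
  then obtain Kx Ky where Kx: "\<And>n. norm ((L ^^ n) x) \<le> Kx" and Ky: "\<And>n. norm ((L ^^ n) y) \<le> Ky"
    unfolding bounded_orbit_def by blast
  have "norm ((L ^^ n) (x + y)) \<le> Kx + Ky" for n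
    using Kx[of n] Ky[of n] norm_triangle_ineq[of "(L ^^ n) x" "(L ^^ n) y"]
    by (simp add: linear_add[OF lin])
  then show "x + y \<in> bounded_orbit L" unfolding bounded_orbit_def by blast
  fix c :: real
  have "norm ((L ^^ n) (c *\<^sub>R x)) \<le> \<bar>c\<bar> * Kx" for n
    using Kx[of n] by (simp add: linear_scale[OF lin] mult_left_mono)
  then show "c *\<^sub>R x \<in> bounded_orbit L" unfolding bounded_orbit_def by blast
qed

text \<open>\<dots> which is invariant under the map.\<close>
lemma bounded_orbit_invariant:
  assumes "w \<in> bounded_orbit L"
  shows "L w \<in> bounded_orbit L"
proof -
  obtain K where "\<And>n. norm ((L ^^ n) w) \<le> K"
    using assms unfolding bounded_orbit_def by blast
  then have "norm ((L ^^ n) (L w)) \<le> K" for n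
    using funpow_Suc_right[of n L] by (metis comp_apply funpow.simps(2))
  then show ?thesis unfolding bounded_orbit_def by blast
qed

text \<open>An eigenvector of an expanding eigenvalue has an unbounded orbit.\<close>
lemma expanding_eigenvector_unbounded:
  assumes lin: "linear L" and v: "v \<noteq> 0" "L v = l *\<^sub>R v" and l: "1 < \<bar>l\<bar>"
  shows "v \<notin> bounded_orbit L"
proof
  assume "v \<in> bounded_orbit L"
  then obtain K where K: "\<And>n. norm ((L ^^ n) v) \<le> K" unfolding bounded_orbit_def by blast
  have orbit: "(L ^^ n) v = l ^ n *\<^sub>R v" for n
    by (induction n) (simp_all add: v(2) linear_scale[OF lin])
  obtain n where "K / norm v < \<bar>l\<bar> ^ n" using real_arch_pow[OF l] by blast
  then have "K < \<bar>l\<bar> ^ n * norm v" using v(1) by (simp add: pos_divide_less_eq)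
  also have "\<dots> = norm ((L ^^ n) v)" by (simp add: orbit power_abs)
  finally show False using K[of n] by simp
qed

text \<open>An expanding eigenvector of eigenvalue l is independent from the sum of
  the bounded-orbit subspace and a different eigenspace of eigenvalue m.\<close>
lemma eigenvector_independent:
  assumes lin: "linear L" and v: "v \<noteq> 0" "L v = l *\<^sub>R v" and l: "1 < \<bar>l\<bar>" "l \<noteq> m"
    and s: "s \<in> bounded_orbit L" and u: "L u = m *\<^sub>R u" and sum: "a *\<^sub>R v = s + u"
  shows "a = 0"
proof (rule ccontr)
  assume a: "a \<noteq> 0"
  have S: "subspace (bounded_orbit L)" by (rule subspace_bounded_orbit[OF lin])
  have "L s - m *\<^sub>R s = L (a *\<^sub>R v - u) - m *\<^sub>R (a *\<^sub>R v - u)"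
    using sum by (simp add: algebra_simps)
  also have "\<dots> = (a * (l - m)) *\<^sub>R v"
    using v u by (simp add: linear_diff[OF lin] linear_scale[OF lin] algebra_simps)
  finally have "(a * (l - m)) *\<^sub>R v \<in> bounded_orbit L"
    using s bounded_orbit_invariant subspace_diff[OF S] subspace_mul[OF S] by metis
  then have "inverse (a * (l - m)) *\<^sub>R (a * (l - m)) *\<^sub>R v \<in> bounded_orbit L"
    using subspace_mul[OF S] by blast
  moreover have "inverse (a * (l - m)) * (a * (l - m)) = 1"
    using a l by (intro left_inverse) simp
  ultimately have "v \<in> bounded_orbit L" by (simp only: scaleR_scaleR scaleR_one)
  then show False using expanding_eigenvector_unbounded[OF lin v l(1)] by simp
qed

subsection \<open>The displacement set\<close>

text \<open>Vectors of the form (bounded orbit) + (m-eigenvector) + (integer vector).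
  Along su-paths the conjugacy moves points only by such vectors.\<close>
definition displacements :: "(real^3 \<Rightarrow> real^3) \<Rightarrow> real \<Rightarrow> (real^3) set" where
  "displacements L m =
     {s + u + k | s u k. s \<in> bounded_orbit L \<and> L u = m *\<^sub>R u \<and> int_vec k}"

text \<open>Displacements compose along paths and may be shifted by integer vectors.\<close>
lemma displacements_add:
  assumes lin: "linear L" and "a \<in> displacements L m" "b \<in> displacements L m"
  shows "a + b \<in> displacements L m"
proof -
  obtain s u k where a: "a = s + u + k" "s \<in> bounded_orbit L" "L u = m *\<^sub>R u" "int_vec k"
    using assms(2) unfolding displacements_def by blast
  obtain s' u' k' where b: "b = s' + u' + k'" "s' \<in> bounded_orbit L" "L u' = m *\<^sub>R u'" "int_vec k'"
    using assms(3) unfolding displacements_def by blast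
  have "a + b = (s + s') + (u + u') + (k + k')" using a b by (simp add: algebra_simps)
  moreover have "s + s' \<in> bounded_orbit L"
    using subspace_add[OF subspace_bounded_orbit[OF lin]] a b by blast
  moreover have "L (u + u') = m *\<^sub>R (u + u')"
    using a b by (simp add: linear_add[OF lin] scaleR_add_right)
  ultimately show ?thesis unfolding displacements_def using a b int_vec_add by blast
qed

lemma displacements_diff_int:
  assumes "a \<in> displacements L m" "int_vec k"
  shows "a - k \<in> displacements L m"
proof -
  obtain s u k' where a: "a = s + u + k'" "s \<in> bounded_orbit L" "L u = m *\<^sub>R u" "int_vec k'"
    using assms(1) unfolding displacements_def by blast
  have "a - k = s + u + (k' - k)" using a by simp
  then show ?thesis unfolding displacements_def using a int_vec_diff assms(2) by blast
qed

text \<open>The two kinds of elementary moves: along stable and along unstable leaves.\<close>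
lemma bounded_orbit_displacements:
  assumes "linear L" and "s \<in> bounded_orbit L"
  shows "s \<in> displacements L m"
proof -
  have "s = s + 0 + 0" "L 0 = m *\<^sub>R 0" using linear_0[OF assms(1)] by simp_all
  then show ?thesis unfolding displacements_def using assms(2) int_vec_0 by blast
qed

lemma eigen_int_displacements:
  assumes "linear L" and "L u = m *\<^sub>R u" "int_vec k"
  shows "u + k \<in> displacements L m"
proof -
  have "u + k = 0 + u + k" by simp
  then show ?thesis unfolding displacements_def
    using assms subspace_0[OF subspace_bounded_orbit[OF assms(1)]] by blast
qed

text \<open>The line through an expanding eigenvector of eigenvalue l <> m is not
  contained in the displacement set: it meets each translate of
  bounded_orbit L + E(m) by an integer vector at most once, and there are only
  countably many integer vectors.\<close>
lemma eigenline_escapes_displacements: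
  assumes lin: "linear L" and v: "v \<noteq> 0" "L v = l *\<^sub>R v" and l: "1 < \<bar>l\<bar>" "l \<noteq> m"
  shows "\<exists>t. t *\<^sub>R v \<notin> displacements L m"
proof -
  define hits where "hits k = {t. \<exists>s u. s \<in> bounded_orbit L \<and> L u = m *\<^sub>R u \<and> t *\<^sub>R v = s + u + k}"
    for k
  have single: "t = t'" if t: "t \<in> hits k" and t': "t' \<in> hits k" for t t' k
  proof -
    obtain s u where su: "s \<in> bounded_orbit L" "L u = m *\<^sub>R u" "t *\<^sub>R v = s + u + k"
      using t by (auto simp: hits_def)
    obtain s' u' where su': "s' \<in> bounded_orbit L" "L u' = m *\<^sub>R u'" "t' *\<^sub>R v = s' + u' + k"
      using t' by (auto simp: hits_def)
    have "(t - t') *\<^sub>R v = (s - s') + (u - u')"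
      using su(3) su'(3) by (simp add: algebra_simps)
    moreover have "s - s' \<in> bounded_orbit L"
      using subspace_diff[OF subspace_bounded_orbit[OF lin]] su(1) su'(1) by blast
    moreover have "L (u - u') = m *\<^sub>R (u - u')"
      using su(2) su'(2) by (simp add: linear_diff[OF lin] scaleR_diff_right)
    ultimately have "t - t' = 0" using eigenvector_independent[OF lin v l] by blast
    then show ?thesis by simp
  qed
  have "countable (hits k)" for k
  proof (cases "hits k = {}")
    case False
    then obtain t0 where "t0 \<in> hits k" by blast
    then have "hits k \<subseteq> {t0}" using single by blast
    then show ?thesis by (rule countable_subset) simp
  qed simp
  then have "countable (\<Union>k\<in>{k. int_vec k}. hits k)"
    using countable_int_vecs by (intro countable_UN)
  moreover have "{t. t *\<^sub>R v \<in> displacements L m} \<subseteq> (\<Union>k\<in>{k. int_vec k}. hits k)"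
  proof
    fix t assume "t \<in> {t. t *\<^sub>R v \<in> displacements L m}"
    then obtain s u k where "s \<in> bounded_orbit L" "L u = m *\<^sub>R u" "int_vec k" "t *\<^sub>R v = s + u + k"
      unfolding displacements_def by blast
    then show "t \<in> (\<Union>k\<in>{k. int_vec k}. hits k)" unfolding hits_def by blast
  qed
  ultimately have "countable {t. t *\<^sub>R v \<in> displacements L m}" by (rule countable_subset[rotated])
  then have "{t. t *\<^sub>R v \<in> displacements L m} \<noteq> UNIV" using uncountable_UNIV_real by auto
  then show ?thesis by blast
qed

subsection \<open>Stable curves and the conjugacy\<close>

text \<open>Mean value bound for a curve on [0,1] with bounded velocity.\<close>
lemma curve_displacement_bound:
  fixes g :: "real \<Rightarrow> 'a::real_normed_vector"
  assumes d: "\<And>t. t \<in> {0..1} \<Longrightarrow> (g has_vector_derivative g' t) (at t within {0..1})"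
    and b: "\<And>t. t \<in> {0..1} \<Longrightarrow> norm (g' t) \<le> K" and K: "0 \<le> K"
  shows "norm (g 1 - g 0) \<le> K"
proof -
  have "norm (g 1 - g 0) \<le> K * norm (1 - 0::real)"
  proof (rule differentiable_bound[where S="{0..1}" and f'="\<lambda>t h. h *\<^sub>R g' t"])
    show "(g has_derivative (\<lambda>h. h *\<^sub>R g' x)) (at x within {0..1})" if "x \<in> {0..1}" for x
      using d[OF that] by (simp add: has_vector_derivative_def)
    show "onorm (\<lambda>h. h *\<^sub>R g' x) \<le> K" if "x \<in> {0..1}" for x
    proof (rule onorm_bound)
      fix h :: real
      have "\<bar>h\<bar> * norm (g' x) \<le> \<bar>h\<bar> * K" using b[OF that] by (simp add: mult_left_mono)
      then show "norm (h *\<^sub>R g' x) \<le> K * norm h" by (simp add: mult.commute)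
    qed (use K in auto)
  qed auto
  then show ?thesis by simp
qed

text \<open>Iterates of an everywhere differentiable map are differentiable.\<close>
lemma differentiable_iterate:
  fixes F :: "'a::real_normed_vector \<Rightarrow> 'a"
  assumes "\<And>x. F differentiable (at x)"
  shows "(F ^^ n) differentiable (at x)"
proof (induction n arbitrary: x)
  case 0
  show ?case by (simp add: id_def)
next
  case (Suc n)
  have "((F ^^ n) \<circ> F) differentiable (at x)"
    using Suc assms differentiable_chain_at by blast
  then show ?case by (simp only: funpow_Suc_right)
qed

text \<open>If the derivatives of all iterates of F are uniformly bounded on the line
  field e, then points on a common e-leaf stay at bounded distance under F^n.
  This is the only property of strong stable leaves the theorem needs.\<close>
lemma leaf_orbits_stay_close:
  fixes F :: "real^3 \<Rightarrow> real^3"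
  assumes dF: "\<And>x. F differentiable (at x)"
    and rate: "\<And>x n. norm (frechet_derivative (F ^^ n) (at x) (e x)) \<le> C * norm (e x)"
    and C: "0 \<le> C" and z': "z' \<in> leaf e z"
  shows "\<exists>K. \<forall>n. norm ((F ^^ n) z' - (F ^^ n) z) \<le> K"
proof -
  obtain \<gamma> \<gamma>' where g01: "\<gamma> 0 = z" "\<gamma> 1 = z'" and cg: "continuous_on {0..1} \<gamma>'"
    and dg: "\<And>t. t \<in> {0..1} \<Longrightarrow> (\<gamma> has_vector_derivative \<gamma>' t) (at t within {0..1})"
    and tangent: "\<And>t. t \<in> {0..1} \<Longrightarrow> \<gamma>' t \<in> span {e (\<gamma> t)}"
    using z' unfolding leaf_def tangent_path_def by blast
  obtain L where L: "\<And>t. t \<in> {0..1} \<Longrightarrow> norm (\<gamma>' t) \<le> L" "0 \<le> L"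
  proof -
    have "bounded (\<gamma>' ` {0..1})" by (intro compact_imp_bounded compact_continuous_image cg) auto
    then obtain L0 where "\<forall>y\<in>\<gamma>' ` {0..1}. norm y \<le> L0" using bounded_iff by metis
    then show ?thesis using that[of "max L0 0"] by force
  qed
  have "norm ((F ^^ n) z' - (F ^^ n) z) \<le> C * L" for n
  proof -
    let ?D = "\<lambda>t. frechet_derivative (F ^^ n) (at (\<gamma> t))"
    have hd: "((F ^^ n) has_derivative ?D t) (at (\<gamma> t))" for t
      using differentiable_iterate[OF dF] frechet_derivative_works by blast
    have "norm (((F ^^ n) \<circ> \<gamma>) 1 - ((F ^^ n) \<circ> \<gamma>) 0) \<le> C * L"
    proof (rule curve_displacement_bound[where g'="\<lambda>t. ?D t (\<gamma>' t)"])
      fix t :: real assume t: "t \<in> {0..1}"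
      show "((F ^^ n) \<circ> \<gamma> has_vector_derivative ?D t (\<gamma>' t)) (at t within {0..1})"
        by (rule vector_derivative_diff_chain_within[OF dg[OF t] has_derivative_at_withinI[OF hd]])
      obtain c where c: "\<gamma>' t = c *\<^sub>R e (\<gamma> t)" using tangent[OF t] by (auto simp: span_singleton)
      have "norm (?D t (\<gamma>' t)) = \<bar>c\<bar> * norm (?D t (e (\<gamma> t)))"
        using c linear_scale[OF has_derivative_linear[OF hd]] by simp
      also have "\<dots> \<le> \<bar>c\<bar> * (C * norm (e (\<gamma> t)))" using rate by (intro mult_left_mono) auto
      also have "\<dots> = C * norm (\<gamma>' t)" using c by simp
      also have "\<dots> \<le> C * L" using L(1)[OF t] C by (simp add: mult_left_mono)
      finally show "norm (?D t (\<gamma>' t)) \<le> C * L" .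
    qed (use C L in auto)
    then show ?thesis using g01 by simp
  qed
  then show ?thesis by blast
qed

text \<open>A continuous map commuting with integer translations is at bounded
  distance from the identity (it suffices to look at the unit cube).\<close>
lemma periodic_displacement_bounded:
  fixes H :: "real^3 \<Rightarrow> real^3"
  assumes c: "continuous_on UNIV H" and p: "\<And>x k. int_vec k \<Longrightarrow> H (x + k) = H x + k"
  shows "\<exists>M. \<forall>x. norm (H x - x) \<le> M"
proof -
  have "compact ((\<lambda>x. H x - x) ` cbox 0 1)"
    by (intro compact_continuous_image continuous_intros continuous_on_subset[OF c]) auto
  then obtain M where M: "\<forall>y\<in>cbox 0 1. norm (H y - y) \<le> M"
    using compact_imp_bounded bounded_iff by (metis (no_types, lifting) image_eqI)
  have "norm (H x - x) \<le> M" for x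
  proof -
    define k :: "real^3" where "k = (\<chi> i. of_int \<lfloor>x $ i\<rfloor>)"
    have k: "int_vec k" unfolding int_vec_def k_def by auto
    have cube: "x - k \<in> cbox 0 1" unfolding mem_box_cart k_def
      by (auto simp: of_int_floor_le) (smt (verit) real_of_int_floor_add_one_gt)
    have "H x = H (x - k) + k" using p[OF k, of "x - k"] by simp
    then have "H x - x = H (x - k) - (x - k)" by (simp add: algebra_simps)
    moreover have "norm (H (x - k) - (x - k)) \<le> M" using M cube by blast
    ultimately show ?thesis by (simp only:)
  qed
  then show ?thesis by blast
qed

text \<open>A conjugacy H o F = L o H conjugates all iterates.\<close>
lemma conjugacy_iterate:
  assumes "\<And>x. H (F x) = L (H x)"
  shows "H ((F ^^ n) x) = (L ^^ n) (H x)"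
  by (induction n) (simp_all add: assms)

text \<open>The conjugacy maps pairs of points with close forward orbits to pairs
  whose difference has a bounded orbit under the linear part.\<close>
lemma close_orbits_bounded_orbit:
  fixes H :: "real^3 \<Rightarrow> real^3"
  assumes lin: "linear L" and M: "\<And>x. norm (H x - x) \<le> M"
    and conj: "\<And>x. H (F x) = L (H x)"
    and close: "\<And>n. norm ((F ^^ n) z' - (F ^^ n) z) \<le> K"
  shows "H z' - H z \<in> bounded_orbit L"
proof -
  have "norm ((L ^^ n) (H z' - H z)) \<le> K + 2 * M" for n
  proof -
    let ?a = "(F ^^ n) z'" and ?b = "(F ^^ n) z"
    have "(L ^^ n) (H z' - H z) = (H ?a - ?a) - (H ?b - ?b) + (?a - ?b)"
      by (simp add: linear_diff[OF linear_iterate[OF lin]] conjugacy_iterate[where H=H and F=F and L=L, OF conj])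
    then have "norm ((L ^^ n) (H z' - H z)) \<le> norm (H ?a - ?a) + norm (H ?b - ?b) + norm (?a - ?b)"
      by (smt (verit) norm_triangle_ineq norm_triangle_ineq4)
    then show ?thesis using M[of ?a] M[of ?b] close[of n] by linarith
  qed
  then show ?thesis unfolding bounded_orbit_def by blast
qed

text \<open>With rates b1 < 1, the strong stable derivatives of all iterates are
  uniformly bounded.\<close>
lemma ph_splitting_stable_bounded:
  assumes "ph_splitting F es ec eu"
  shows "\<exists>C\<ge>0. \<forall>x n. norm (frechet_derivative (F ^^ n) (at x) (es x)) \<le> C * norm (es x)"
proof -
  obtain C a1 b1 where C: "0 < C" and b1: "0 < a1" "a1 \<le> b1" "b1 < 1"
    and rate: "\<forall>x n. norm (frechet_derivative (F ^^ n) (at x) (es x)) \<le> C * b1 ^ n * norm (es x)"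
    using assms[unfolded ph_splitting_def, THEN conjunct2, THEN conjunct2] by (elim conjE exE) blast
  have "C * b1 ^ n * norm (es x) \<le> C * norm (es x)" for x n
  proof -
    have "b1 ^ n \<le> 1" using b1 by (intro power_le_one) auto
    then have "C * b1 ^ n * norm (es x) \<le> C * 1 * norm (es x)"
      using C by (intro mult_right_mono mult_left_mono) auto
    then show ?thesis by simp
  qed
  then have "\<forall>x n. norm (frechet_derivative (F ^^ n) (at x) (es x)) \<le> C * norm (es x)"
    using rate order_trans by blast
  then show ?thesis using C by (intro exI[of _ C]) simp
qed

subsection \<open>Confinement of su-paths and the theorem\<close>

text \<open>The hypothesis that H maps strong unstable leaves onto linear unstable
  leaves modulo Z^3 says that H moves points of an unstable leaf by an
  l-eigenvector plus an integer vector.\<close>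
lemma unstable_leaf_displacement:
  assumes leaves: "\<forall>p. zsat (H ` leaf eu p) = zsat (lin_leaf A l (H p))"
    and z': "z' \<in> leaf eu z"
  shows "\<exists>u k. realA A *v u = l *\<^sub>R u \<and> int_vec k \<and> H z' - H z = u + k"
proof -
  have "H z' \<in> zsat (H ` leaf eu z)" unfolding zsat_def using z' int_vec_0 by force
  then have "H z' \<in> zsat (lin_leaf A l (H z))" using leaves by simp
  then obtain v where v: "realA A *v v = l *\<^sub>R v" "int_vec (H z' - (H z + v))"
    unfolding zsat_def lin_leaf_def by blast
  have "H z' - H z = v + (H z' - (H z + v))" by simp
  then show ?thesis using v by blast
qed

text \<open>Along su-paths the conjugacy only moves points by displacements.\<close>
lemma su_paths_confined:
  fixes H :: "real^3 \<Rightarrow> real^3"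
  assumes lin: "linear L"
    and stable: "\<And>z z'. z' \<in> leaf es z \<Longrightarrow> H z' - H z \<in> bounded_orbit L"
    and unstable: "\<And>z z'. z' \<in> leaf eu z \<Longrightarrow> \<exists>u k. L u = m *\<^sub>R u \<and> int_vec k \<and> H z' - H z = u + k"
    and path: "(x, z) \<in> (su_step es eu)\<^sup>*"
  shows "H z - H x \<in> displacements L m"
  using path
proof (induction rule: rtrancl_induct)
  case base
  show ?case using bounded_orbit_displacements[OF lin subspace_0[OF subspace_bounded_orbit[OF lin]]]
    by simp
next
  case (step y z)
  have "z \<in> leaf es y \<or> z \<in> leaf eu y" using step(2) unfolding su_step_def by simp
  then have "H z - H y \<in> displacements L m"
  proof
    assume "z \<in> leaf es y"
    then show ?thesis using stable bounded_orbit_displacements[OF lin] by blast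
  next
    assume "z \<in> leaf eu y"
    then obtain u k where "L u = m *\<^sub>R u" "int_vec k" "H z - H y = u + k" using unstable by blast
    then show ?thesis using eigen_int_displacements[OF lin] by simp
  qed
  from displacements_add[OF lin step(3) this] show ?case by simp
qed

text \<open>If along su-paths a periodic surjective H only moves points by vectors of
  a set D stable under integer translations, and some vector w lies outside D,
  then the point H^{-1}(H 0 + w) is not accessible from 0 modulo Z^3.\<close>
lemma not_accessible_if_confined:
  fixes H :: "real^3 \<Rightarrow> real^3"
  assumes per: "\<And>x k. int_vec k \<Longrightarrow> H (x + k) = H x + k" and surj: "surj H"
    and confined: "\<And>x z. (x, z) \<in> (su_step es eu)\<^sup>* \<Longrightarrow> H z - H x \<in> D"
    and shift: "\<And>a k. a \<in> D \<Longrightarrow> int_vec k \<Longrightarrow> a - k \<in> D"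
    and w: "w \<notin> D"
  shows "\<not> accessible es eu"
proof
  assume "accessible es eu"
  obtain y where y: "H y = H 0 + w" using surj by (metis surjD)
  obtain z where z: "(0, z) \<in> (su_step es eu)\<^sup>*" "int_vec (z - y)"
    using \<open>accessible es eu\<close> unfolding accessible_def by blast
  have "H z = H y + (z - y)" using per[OF z(2), of y] by simp
  then have "w = (H z - H 0) - (z - y)" using y by simp
  moreover have "(H z - H 0) - (z - y) \<in> D" using shift[OF confined[OF z(1)] z(2)] .
  ultimately show False using w by simp
qed

theorem mainTheorem2:
  fixes A :: "int^3^3" and l1 l2 l3 :: real
  assumes "det A = 1"
    and "0 < l1" and "l1 < 1" and "1 < l2" and "l2 < l3"
    and "\<forall>l\<in>{l1, l2, l3}. \<exists>v. v \<noteq> 0 \<and> realA A *v v = l *\<^sub>R v"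
  shows "\<exists>\<epsilon>>0. \<forall>F F'.
     torus_lift_diffeo A F F' \<and>
     (\<forall>x. norm (F x - realA A *v x) < \<epsilon> \<and> norm (F' x - realA A) < \<epsilon>) \<longrightarrow>
     (\<forall>es ec eu. ph_splitting F es ec eu \<longrightarrow>
       (\<forall>H. torus_conj A F H \<longrightarrow>
          (\<forall>p. zsat (H ` leaf eu p) = zsat (lin_leaf A l3 (H p))) \<longrightarrow>
          \<not> accessible es eu))"
proof (intro exI[of _ "1::real"] conjI allI impI)
  let ?L = "(*v) (realA A)"
  have lin: "linear ?L" by simp
  obtain v where v: "v \<noteq> 0" "?L v = l2 *\<^sub>R v" using assms(6) by auto
  have "1 < \<bar>l2\<bar>" "l2 \<noteq> l3" using assms(4,5) by auto
  then obtain t where t: "t *\<^sub>R v \<notin> displacements ?L l3"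
    using eigenline_escapes_displacements[OF lin v] by blast
  fix F F' es ec eu H
  assume F: "torus_lift_diffeo A F F' \<and> (\<forall>x. norm (F x - realA A *v x) < 1 \<and> norm (F' x - realA A) < 1)"
    and ph: "ph_splitting F es ec eu" and conj: "torus_conj A F H"
    and leaves: "\<forall>p. zsat (H ` leaf eu p) = zsat (lin_leaf A l3 (H p))"
  have dF: "\<And>x. F differentiable (at x)"
    using F unfolding torus_lift_diffeo_def differentiable_def by blast
  obtain G where hom: "homeomorphism UNIV UNIV H G" and per: "\<And>x k. int_vec k \<Longrightarrow> H (x + k) = H x + k"
    and HF: "\<And>x. H (F x) = ?L (H x)"
    using conj unfolding torus_conj_def by blast
  obtain C where C: "0 \<le> C" "\<And>x n. norm (frechet_derivative (F ^^ n) (at x) (es x)) \<le> C * norm (es x)"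
    using ph_splitting_stable_bounded[OF ph] by blast
  obtain M where M: "\<And>x. norm (H x - x) \<le> M"
    using periodic_displacement_bounded[OF homeomorphism_cont1[OF hom] per] by blast
  have stable: "H z' - H z \<in> bounded_orbit ?L" if "z' \<in> leaf es z" for z z'
    using leaf_orbits_stay_close[OF dF C(2) C(1) that] close_orbits_bounded_orbit[OF lin M HF] by blast
  have unstable: "\<exists>u k. ?L u = l3 *\<^sub>R u \<and> int_vec k \<and> H z' - H z = u + k"
    if "z' \<in> leaf eu z" for z z'
    using unstable_leaf_displacement[OF leaves that] .
  have "surj H" using hom unfolding homeomorphism_def by blast
  from not_accessible_if_confined[OF per this su_paths_confined[OF lin stable unstable]
      displacements_diff_int t]
  show "\<not> accessible es eu" .
qed simp

end
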